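(* Let $k,C\ge1$ be integers. There exists an alphabet $\Sigma\subset\mathbb{N}$ of size $k$ such that, for every $C$-balanced infinite word $\mathbf{w}$ over $\Sigma$, $\rho^{\mathrm{add}}_{\mathbf{w}}=\rho^{\mathrm{ab}}_{\mathbf{w}}$.
   Context: For a word $w$, $|w|_a$ counts occurrences of $a$. An infinite word $\mathbf{w}$ is $C$-balanced if $\big||u|_a-|v|_a\big|\le C$ for all letters $a$ and all factors $u,v$ of $\mathbf{w}$ with $|u|=|v|$. Words $u,v$ over $\Sigma\subset\mathbb{N}$ are abelian equivalent if $|u|_a=|v|_a$ for all $a\in\Sigma$, and additively equivalent if $|u|=|v|$ and $\sum_{a\in\Sigma}a|u|_a=\sum_{a\in\Sigma}a|v|_a$. $\rho^{\mathrm{ab}}_{\mathbf{w}}(n)$ (resp. $\rho^{\mathrm{add}}_{\mathbf{w}}(n)$) is the number of abelian (resp. additive) equivalence classes of length-$n$ factors of $\mathbf{w}$. *)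

theory Defs
  imports "HOL-Library.Omega_Words_Fun"
begin

text \<open>Infinite words are of type \<^typ>\<open>'a word\<close>, i.e. functions on \<^typ>\<open>nat\<close>; the factor of
  \<^term>\<open>w\<close> of length \<^term>\<open>n\<close> at position \<^term>\<open>i\<close> is \<^term>\<open>w [i \<rightarrow> i + n]\<close>. The number
  of occurrences of a letter in a finite word is \<^const>\<open>count_list\<close>.\<close>

definition factors :: "'a word \<Rightarrow> 'a list set" where
  "factors w = {w [i \<rightarrow> j] | i j. i \<le> j}"

definition factors_of_length :: "'a word \<Rightarrow> nat \<Rightarrow> 'a list set" where
  "factors_of_length w n = {u \<in> factors w. length u = n}"

text \<open>Quantifying over every \<^term>\<open>a :: 'a\<close> rather than over a given alphabet makes no difference:
  a letter not in the word has zero occurrences in all factors.\<close>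

definition balanced :: "nat \<Rightarrow> 'a word \<Rightarrow> bool" where
  "balanced C w \<longleftrightarrow>
     (\<forall>a. \<forall>u \<in> factors w. \<forall>v \<in> factors w. length u = length v \<longrightarrow>
        \<bar>int (count_list u a) - int (count_list v a)\<bar> \<le> int C)"

definition abelian_equivalence :: "'a set \<Rightarrow> ('a list \<times> 'a list) set" where
  "abelian_equivalence \<Sigma> =
     {(u, v). u \<in> lists \<Sigma> \<and> v \<in> lists \<Sigma> \<and> (\<forall>a\<in>\<Sigma>. count_list u a = count_list v a)}"

definition additive_equivalence :: "nat set \<Rightarrow> (nat list \<times> nat list) set" where
  "additive_equivalence \<Sigma> =
     {(u, v). u \<in> lists \<Sigma> \<and> v \<in> lists \<Sigma> \<and> length u = length v \<and>
        (\<Sum>a\<in>\<Sigma>. a * count_list u a) = (\<Sum>a\<in>\<Sigma>. a * count_list v a)}"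

lemma equiv_abelian_equivalence: "equiv (lists \<Sigma>) (abelian_equivalence \<Sigma>)"
  by (rule equivI) (auto simp: abelian_equivalence_def refl_on_def sym_def trans_def)

lemma equiv_additive_equivalence: "equiv (lists \<Sigma>) (additive_equivalence \<Sigma>)"
  by (rule equivI) (auto simp: additive_equivalence_def refl_on_def sym_def trans_def)

text \<open>The complexity functions are meant for words over a finite alphabet \<^term>\<open>\<Sigma>\<close>; then the
  quotients below are finite.\<close>

definition abelian_complexity :: "'a set \<Rightarrow> 'a word \<Rightarrow> nat \<Rightarrow> nat" where
  "abelian_complexity \<Sigma> w n = card (factors_of_length w n // abelian_equivalence \<Sigma>)"

definition additive_complexity :: "nat set \<Rightarrow> nat word \<Rightarrow> nat \<Rightarrow> nat" where
  "additive_complexity \<Sigma> w n = card (factors_of_length w n // additive_equivalence \<Sigma>)"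

lemma finite_factors_of_length:
  assumes "finite \<Sigma>" "range w \<subseteq> \<Sigma>"
  shows "finite (factors_of_length w n)"
proof (rule finite_subset)
  show "factors_of_length w n \<subseteq> {u. set u \<subseteq> \<Sigma> \<and> length u = n}"
    using assms(2) by (auto simp: factors_of_length_def factors_def image_subset_iff)
  show "finite {u. set u \<subseteq> \<Sigma> \<and> length u = n}"
    using assms(1) by (rule finite_lists_length_eq)
qed

end

theory Submission
  imports Defs
begin

text \<open>Take the letters to be the powers of \<open>C + 1\<close>. In a \<open>C\<close>-balanced word the letter counts of two
  factors of the same length differ by at most \<open>C\<close>, and an integer has at most one expansion in base
  \<open>C + 1\<close> up to such a difference: reducing modulo \<open>C + 1\<close> determines the lowest digit.\<close>

text \<open>Induction on \<open>k\<close> with \<open>d\<close> generalised, so that the hypothesis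
  can be applied to the shifted digits. All summands except \<open>d 0\<close> are multiples of
  \<open>b\<close>, and 0 is the only multiple of \<open>b\<close> of absolute value below
  \<open>b\<close>.\<close>

lemma signed_digits_eq_0:
  fixes d :: "nat \<Rightarrow> int"
  assumes "\<And>i. i < k \<Longrightarrow> \<bar>d i\<bar> < b" and "(\<Sum>i<k. b ^ i * d i) = 0" and "i < k"
  shows "d i = 0"
  using assms
proof (induction k arbitrary: d i)
  case 0
  then show ?case by simp
next
  case (Suc k)
  have b: "b > 0"
    using Suc.prems(1)[of 0] by linarith
  have split: "d 0 + b * (\<Sum>i<k. b ^ i * d (Suc i)) = 0"
    using Suc.prems(2) by (simp add: sum.lessThan_Suc_shift sum_distrib_left mult.assoc del: sum.lessThan_Suc)
  then have "b dvd d 0"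
    by (metis add_eq_0_iff2 dvd_minus_iff dvd_triv_left)
  then have d0: "d 0 = 0"
    using Suc.prems(1)[of 0] dvd_imp_le_int[of "d 0" b] by force
  \<comment> \<open>As \<open>d 0\<close> vanishes and \<open>b\<close> is positive,
    \<open>b\<close> cancels from \<open>split\<close>.\<close>
  have "d (Suc j) = 0" if "j < k" for j
    using Suc.IH[of "\<lambda>i. d (Suc i)" j] Suc.prems(1) split d0 b that by simp
  then show ?case
    using d0 Suc.prems(3) by (cases i) auto
qed

text \<open>The classes are formed in all of \<open>A\<close>, so \<open>r\<close> and
  \<open>s\<close> may give different quotients of \<open>B\<close> even though they agree on
  \<open>B\<close>. Sending an \<open>r\<close>-class to its image under \<open>s\<close> is a
  bijection between the two quotients.\<close>

lemma card_quotient_coarser: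
  assumes "equiv A r" "equiv A s" "r \<subseteq> s" "B \<subseteq> A"
    and "\<And>x y. x \<in> B \<Longrightarrow> y \<in> B \<Longrightarrow> (x, y) \<in> s \<Longrightarrow> (x, y) \<in> r"
  shows "card (B // s) = card (B // r)"
proof -
  have image: "s `` (r `` {x}) = s `` {x}" if "x \<in> B" for x
  proof
    have "trans s" "(x, x) \<in> r"
      using assms(1,2,4) that by (auto simp: equiv_def refl_on_def)
    then show "s `` (r `` {x}) \<subseteq> s `` {x}" "s `` {x} \<subseteq> s `` (r `` {x})"
      using assms(3) by (auto dest: transD)
  qed
  have "inj_on ((``) s) (B // r)"
  proof (rule inj_onI)
    fix X Y assume "X \<in> B // r" "Y \<in> B // r" and eq: "s `` X = s `` Y"
    then obtain x y where xy: "x \<in> B" "y \<in> B" "X = r `` {x}" "Y = r `` {y}"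
      by (auto elim!: quotientE)
    then have "(x, y) \<in> s"
      using eq image assms(2,4) by (metis eq_equiv_class subsetD)
    then show "X = Y"
      using xy assms(1,5) equiv_class_eq by metis
  qed
  moreover have "(``) s ` (B // r) = B // s"
    using image by (auto simp: quotient_def image_UN)
  ultimately show ?thesis
    by (metis card_image)
qed

lemma abelian_subset_additive_equivalence:
  assumes "finite \<Sigma>"
  shows "abelian_equivalence \<Sigma> \<subseteq> additive_equivalence \<Sigma>"
proof (rule subrelI)
  fix u v assume "(u, v) \<in> abelian_equivalence \<Sigma>"
  then have uv: "u \<in> lists \<Sigma>" "v \<in> lists \<Sigma>" "\<forall>a\<in>\<Sigma>. count_list u a = count_list v a"
    by (auto simp: abelian_equivalence_def)
  \<comment> \<open>Equal lengths are part of additive equivalence only; here they follow from equal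
    letter counts.\<close>
  have "length u = (\<Sum>a\<in>\<Sigma>. count_list u a)" "length v = (\<Sum>a\<in>\<Sigma>. count_list v a)"
    using uv assms by (metis sum_count_set in_lists_conv_set subsetI)+
  then show "(u, v) \<in> additive_equivalence \<Sigma>"
    using uv by (simp add: additive_equivalence_def)
qed

lemma additive_imp_abelian_equivalence:
  fixes C k :: nat
  defines "\<Sigma> \<equiv> (\<lambda>i. Suc C ^ i) ` {..<k}"
  assumes "C \<ge> 1" and "balanced C w" and "u \<in> factors w" "v \<in> factors w"
    and "(u, v) \<in> additive_equivalence \<Sigma>"
  shows "(u, v) \<in> abelian_equivalence \<Sigma>"
proof -
  define d where "d i = int (count_list u (Suc C ^ i)) - int (count_list v (Suc C ^ i))" for i
  have uv: "u \<in> lists \<Sigma>" "v \<in> lists \<Sigma>" "length u = length v"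
      "(\<Sum>a\<in>\<Sigma>. a * count_list u a) = (\<Sum>a\<in>\<Sigma>. a * count_list v a)"
    using assms(6) by (auto simp: additive_equivalence_def)
  \<comment> \<open>Distinct exponents give distinct letters because the base is at least 2. Sums
    over letters thus become sums over exponents, and the weighted letter sums become expansions in
    base \<open>Suc C\<close>.\<close>
  have inj: "inj_on (\<lambda>i. Suc C ^ i) {..<k}"
    using assms(2) by (intro inj_onI) (simp add: power_inject_exp)
  have "(\<Sum>i<k. Suc C ^ i * count_list u (Suc C ^ i)) = (\<Sum>i<k. Suc C ^ i * count_list v (Suc C ^ i))"
    using uv(4) unfolding \<Sigma>_def sum.reindex[OF inj] by simp
  then have "(\<Sum>i<k. int (Suc C ^ i * count_list u (Suc C ^ i)))
      = (\<Sum>i<k. int (Suc C ^ i * count_list v (Suc C ^ i)))"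
    by (metis of_nat_sum)
  then have sum: "(\<Sum>i<k. int (Suc C) ^ i * d i) = 0"
    by (simp add: d_def right_diff_distrib sum_subtractf)
  have "\<bar>d i\<bar> < int (Suc C)" for i
  proof -
    have "\<bar>d i\<bar> \<le> int C"
      using assms(3-5) uv(3) unfolding balanced_def d_def by blast
    then show ?thesis by simp
  qed
  then have "d i = 0" if "i < k" for i
    using signed_digits_eq_0[OF _ sum that] by blast
  then show ?thesis
    using uv(1,2) by (auto simp: abelian_equivalence_def \<Sigma>_def d_def)
qed

theorem theorem5p2:
  fixes k C :: nat
  assumes "k \<ge> 1" and "C \<ge> 1"
  shows "\<exists>\<Sigma> :: nat set. finite \<Sigma> \<and> card \<Sigma> = k \<and>
           (\<forall>w :: nat word. range w \<subseteq> \<Sigma> \<longrightarrow> balanced C w \<longrightarrow>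
              additive_complexity \<Sigma> w = abelian_complexity \<Sigma> w)"
proof -
  define \<Sigma> where "\<Sigma> = (\<lambda>i. Suc C ^ i) ` {..<k}"
  have fin: "finite \<Sigma>"
    by (simp add: \<Sigma>_def)
  have "card \<Sigma> = k"
    using assms(2) unfolding \<Sigma>_def
    by (subst card_image) (auto intro!: inj_onI simp: power_inject_exp)
  moreover have "additive_complexity \<Sigma> w = abelian_complexity \<Sigma> w"
    if w: "range w \<subseteq> \<Sigma>" "balanced C w" for w
  proof
    fix n
    have "factors_of_length w n \<subseteq> lists \<Sigma>"
      using w(1) by (auto simp: factors_of_length_def factors_def image_subset_iff)
    \<comment> \<open>Additive equivalence is the coarser relation; balancedness makes it imply
      abelian equivalence on the factors of \<open>w\<close>.\<close>
    then show "additive_complexity \<Sigma> w n = abelian_complexity \<Sigma> w n"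
      unfolding additive_complexity_def abelian_complexity_def
      using additive_imp_abelian_equivalence[OF assms(2) w(2), of _ _ k]
      by (intro card_quotient_coarser[OF equiv_abelian_equivalence equiv_additive_equivalence
            abelian_subset_additive_equivalence[OF fin]])
        (auto simp: \<Sigma>_def factors_of_length_def)
  qed
  ultimately show ?thesis
    using fin by blast
qed

end
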